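(* Let $G$ be an abelian group and let $\varphi\in\mathrm{End}(G)$. Then $s(\varphi^k)=k\,s(\varphi)$, $ns(\varphi^k)=k\,ns(\varphi)$ and $s_0(\varphi^k)=k\,s_0(\varphi)$ for every integer $k\geq 1$.
   Context: $\mathbb N=\{0,1,2,\dots\}$ and $\mathbb N_+=\mathbb N\setminus\{0\}$. For an endomorphism $\varphi$ of an abelian group $G$: $Q\mathrm{Per}(\varphi)$ is the set of $x\in G$ such that $\varphi^n(x)=\varphi^m(x)$ for some $n<m$ in $\mathbb N$. A string of $\varphi$ is a sequence $S=\{x_n\}_{n\in\mathbb N}$ of pairwise distinct elements of $G$ with $\varphi(x_n)=x_{n-1}$ for every $n\in\mathbb N_+$. A string is singular if $x_0\in Q\mathrm{Per}(\varphi)$, and non-singular otherwise; it is a null string if $x_0\neq 0$ and $\varphi^k(x_0)=0$ for some $k\in\mathbb N_+$. The numbers $s(\varphi)$, $ns(\varphi)$, $s_0(\varphi)$ are the suprema of $|\mathcal F|$ over all families $\mathcal F$ of pairwise disjoint strings, respectively non-singular strings, respectively null strings, of $\varphi$ in $G$ (disjointness refers to the underlying sets of elements). They take values in $\mathbb N\cup\{\infty\}$: each is set equal to $\infty$ whenever the supremum is infinite; $k\cdot\infty=\infty$ for $k\in\mathbb N_+$. *)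

theory Defs
  imports Complex_Main "HOL-Library.Extended_Nat" "HOL-Library.Disjoint_Sets"
begin

definition quasi_periodic :: "('a \<Rightarrow> 'a) \<Rightarrow> 'a set" where
  "quasi_periodic \<phi> = {x. \<exists>n m. n < m \<and> (\<phi> ^^ n) x = (\<phi> ^^ m) x}"

definition strings :: "('a \<Rightarrow> 'a) \<Rightarrow> (nat \<Rightarrow> 'a) set" where
  "strings \<phi> = {S. inj S \<and> (\<forall>n\<ge>1. \<phi> (S n) = S (n - 1))}"

definition nonsingular_strings :: "('a \<Rightarrow> 'a) \<Rightarrow> (nat \<Rightarrow> 'a) set" where
  "nonsingular_strings \<phi> = {S \<in> strings \<phi>. S 0 \<notin> quasi_periodic \<phi>}"

definition null_strings :: "('a::zero \<Rightarrow> 'a) \<Rightarrow> (nat \<Rightarrow> 'a) set" where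
  "null_strings \<phi> = {S \<in> strings \<phi>. S 0 \<noteq> 0 \<and> (\<exists>k\<ge>1. (\<phi> ^^ k) (S 0) = 0)}"

definition ecard :: "'b set \<Rightarrow> enat" where
  "ecard F = (if finite F then enat (card F) else \<infinity>)"

(* Families are sets of strings. Nothing is lost against indexed families:
   ranges of strings are nonempty, so disjoint members are distinct. *)
definition max_disjoint :: "(nat \<Rightarrow> 'a) set \<Rightarrow> enat" where
  "max_disjoint \<S> = (SUP F \<in> {F. F \<subseteq> \<S> \<and> disjoint_family_on range F}. ecard F)"

definition string_number :: "('a \<Rightarrow> 'a) \<Rightarrow> enat" where
  "string_number \<phi> = max_disjoint (strings \<phi>)"

definition nonsingular_string_number :: "('a \<Rightarrow> 'a) \<Rightarrow> enat" where
  "nonsingular_string_number \<phi> = max_disjoint (nonsingular_strings \<phi>)"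

definition null_string_number :: "('a::zero \<Rightarrow> 'a) \<Rightarrow> enat" where
  "null_string_number \<phi> = max_disjoint (null_strings \<phi>)"

end

theory Submission
  imports Defs
begin

text \<open>
  The argument is combinatorial and looks only at how the iterates of \<open>\<phi>\<close> move points.
  In all three cases the strings concerned are those whose starting point
  lies in a set \<open>A\<close> that is closed under preimages and is the same for \<open>\<phi>\<close> and \<open>\<phi> ^^ k\<close>: the whole
  group, the complement of the quasi-periodic points, or the nonzero points that are eventually
  sent to zero. The last set has these two properties because \<open>\<phi> 0 = 0\<close>. Closure under preimages means that each later term of such a string is
  in \<open>A\<close> too, so strings may be cut off at the beginning or thinned out at will.

  One direction is immediate: a string \<open>S\<close> of \<open>\<phi>\<close> splits, by the residue of the index modulo
  \<open>k\<close>, into \<open>k\<close> disjoint strings of \<open>\<phi> ^^ k\<close>.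

  For the other direction, let \<open>F\<close> be a finite disjoint family of strings of \<open>\<phi> ^^ k\<close>. Filling the
  gaps of \<open>T \<in> F\<close> with the iterates of its terms under \<open>\<phi>\<close> gives a backward orbit \<open>V\<close> of \<open>\<phi>\<close>. Such
  a sequence need not be injective, since it may start on a cycle, but as its range is infinite
  some tail of it is (\<open>eventually_inj_on_tail\<close>). Two backward orbits with injective tails either
  share a tail up to a shift of the index or have disjoint tails
  (\<open>eventually_disjoint_tails\<close>). At most \<open>k\<close> members of \<open>F\<close> have fillings sharing a tail with a
  given one, because two members that
  meet that tail in the same residue class modulo \<open>k\<close> have a common
  term (\<open>card_common_tail_le\<close>). So at least \<open>card F / k\<close> fillings have pairwise
  different tails, and cut off sufficiently far out they are disjoint strings of \<open>\<phi>\<close>.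
\<close>

section \<open>Families of disjoint strings\<close>

text \<open>Finite families suffice to compute the supremum: every family with at least \<open>n\<close> members,
  infinite or not, contains one with exactly \<open>n\<close>.\<close>

lemma enat_le_max_disjointE:
  assumes "enat n \<le> max_disjoint \<S>"
  obtains F where "F \<subseteq> \<S>" "finite F" "card F = n" "disjoint_family_on range F"
proof -
  have "\<exists>F \<in> {F. F \<subseteq> \<S> \<and> disjoint_family_on range F}. enat n \<le> ecard F"
  proof (cases n)
    case 0
    then show ?thesis by (auto simp: disjoint_family_on_def zero_enat_def[symmetric])
  next
    case (Suc m)
    then have "enat m < max_disjoint \<S>"
      using assms by (cases "max_disjoint \<S>") auto
    then obtain F where "F \<subseteq> \<S>" "disjoint_family_on range F" "enat m < ecard F"
      unfolding max_disjoint_def less_SUP_iff by auto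
    then show ?thesis
      using Suc by (intro bexI[of _ F]) (auto simp: ecard_def)
  qed
  then obtain F where F: "F \<subseteq> \<S>" "disjoint_family_on range F" "enat n \<le> ecard F"
    by auto
  obtain F' where F': "F' \<subseteq> F" "finite F'" "card F' = n"
  proof (cases "finite F")
    case True
    then have "n \<le> card F" using F(3) by (simp add: ecard_def)
    then show ?thesis
      by (metis obtain_subset_with_card_n that)
  next
    case False
    then show ?thesis using infinite_arbitrarily_large that by blast
  qed
  show thesis
  proof (rule that)
    show "F' \<subseteq> \<S>" using F F' by blast
    show "disjoint_family_on range F'" using F F' disjoint_family_on_mono by blast
  qed (use F' in auto)
qed

lemma card_le_max_disjoint:
  fixes h :: "'i \<Rightarrow> nat \<Rightarrow> 'a"
  assumes "finite X" "\<And>x. x \<in> X \<Longrightarrow> h x \<in> \<S>"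
    and disj: "disjoint_family_on (\<lambda>x. range (h x)) X"
  shows "enat (card X) \<le> max_disjoint \<S>"
proof -
  have "inj_on h X"
  proof (rule inj_onI, rule ccontr)
    fix x y assume "x \<in> X" "y \<in> X" "h x = h y" "x \<noteq> y"
    then have "range (h x) \<inter> range (h x) = {}"
      using disj unfolding disjoint_family_on_def by metis
    then show False by simp
  qed
  then have "ecard (h ` X) = enat (card X)"
    using assms(1) by (simp add: ecard_def card_image)
  moreover have "disjoint_family_on range (h ` X)"
    using disj unfolding disjoint_family_on_def by (metis imageE)
  ultimately show ?thesis
    unfolding max_disjoint_def using assms(2)
    by (intro SUP_upper2[of "h ` X"]) auto
qed

text \<open>The equation is reduced to statements about finite families; when \<open>x\<close> or \<open>y\<close> is infinite,
  the bounds for all natural numbers force the other one to be infinite.\<close>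

lemma enat_eq_multI:
  fixes x y :: enat
  assumes "k \<ge> 1"
    and lower: "\<And>n. enat n \<le> y \<Longrightarrow> enat (k * n) \<le> x"
    and upper: "\<And>m. enat m \<le> x \<Longrightarrow> \<exists>n. m \<le> k * n \<and> enat n \<le> y"
  shows "x = enat k * y"
proof (rule antisym)
  show "enat k * y \<le> x"
  proof (cases y)
    case (enat n)
    then show ?thesis using lower[of n] by simp
  next
    case infinity
    have "enat n \<le> x" for n
      using lower[of n] infinity assms(1) order_trans[of "enat n" "enat (k * n)" x] by simp
    then have "x = \<infinity>"
      by (metis Suc_n_not_le_n enat.exhaust enat_ord_simps(1))
    then show ?thesis by simp
  qed
next
  show "x \<le> enat k * y"
  proof (cases y)
    case (enat r)
    have bound: "m \<le> k * r" if "enat m \<le> x" for m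
      using upper[OF that] enat by (auto intro: order_trans)
    show ?thesis
    proof (cases x)
      case (enat m)
      then show ?thesis using bound[of m] \<open>y = enat r\<close> by simp
    next
      case infinity
      then show ?thesis using bound[of "Suc (k * r)"] by simp
    qed
  next
    case infinity
    then show ?thesis using assms(1) by (simp add: zero_enat_def)
  qed
qed

section \<open>Backward orbits and their tails\<close>

definition backward_orbit :: "('a \<Rightarrow> 'a) \<Rightarrow> (nat \<Rightarrow> 'a) \<Rightarrow> bool" where
  "backward_orbit \<phi> V \<longleftrightarrow> (\<forall>n. \<phi> (V (Suc n)) = V n)"

lemma strings_iff: "S \<in> strings \<phi> \<longleftrightarrow> inj S \<and> backward_orbit \<phi> S"
proof -
  have "(\<forall>n\<ge>1. \<phi> (S n) = S (n - 1)) \<longleftrightarrow> (\<forall>n. \<phi> (S (Suc n)) = S n)"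
    by (metis Suc_le_mono Suc_pred diff_Suc_1 le0 One_nat_def less_eq_Suc_le)
  then show ?thesis by (simp add: strings_def backward_orbit_def)
qed

lemma backward_orbit_funpow:
  assumes "backward_orbit \<phi> V"
  shows "(\<phi> ^^ j) (V (n + j)) = V n"
proof (induction j)
  case (Suc j)
  then show ?case
    using assms by (simp add: backward_orbit_def funpow_swap1)
qed simp

lemma backward_orbit_funpow_diff:
  assumes "backward_orbit \<phi> V" "j \<le> n"
  shows "(\<phi> ^^ j) (V n) = V (n - j)"
  using backward_orbit_funpow[OF assms(1), of j "n - j"] assms(2) by simp

lemma backward_orbit_mem:
  assumes "backward_orbit \<phi> V" "V 0 \<in> A" and closed: "\<And>x. \<phi> x \<in> A \<Longrightarrow> x \<in> A"
  shows "V n \<in> A"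
proof (induction n)
  case (Suc n)
  then show ?case using assms(1) closed[of "V (Suc n)"] by (simp add: backward_orbit_def)
qed (use assms in simp)

lemma funpow_fixpoint:
  assumes "(f ^^ p) x = x"
  shows "(f ^^ (p * n)) x = x"
  by (induction n) (simp_all add: funpow_add assms)

text \<open>If no tail were injective, terms arbitrarily far out would be periodic. Then every term,
  being an image of such a term, would be periodic and so lie in the forward orbit of \<open>V 0\<close>. As
  \<open>V 0\<close> itself is periodic, this orbit is a finite cycle.\<close>

lemma eventually_inj_on_tail:
  assumes V: "backward_orbit \<phi> V" and inf: "infinite (range V)"
  shows "\<forall>\<^sub>F N in sequentially. inj_on V {N..}"
proof -
  have "\<exists>N. inj_on V {N..}"
  proof (rule ccontr)
    assume *: "\<nexists>N. inj_on V {N..}"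
    have per: "\<exists>p>0. (\<phi> ^^ p) (V n) = V n" for n
    proof -
      obtain a b where ab: "n \<le> a" "a < b" "V a = V b"
        using * unfolding inj_on_def by (metis atLeast_iff linorder_neqE_nat)
      have "b - n = (b - a) + (a - n)"
        using ab by simp
      moreover have "(\<phi> ^^ (a - n)) (V a) = V n"
        using ab(1) by (simp add: backward_orbit_funpow_diff[OF V])
      ultimately have "(\<phi> ^^ (b - a)) (V n) = (\<phi> ^^ (b - n)) (V b)"
        by (simp add: funpow_add ab(3)[symmetric])
      also have "\<dots> = V n"
        using ab by (simp add: backward_orbit_funpow_diff[OF V])
      finally show ?thesis using ab by (intro exI[of _ "b - a"]) simp
    qed
    obtain q where q: "q > 0" "(\<phi> ^^ q) (V 0) = V 0"
      using per by blast
    have "V n \<in> (\<lambda>i. (\<phi> ^^ i) (V 0)) ` {..<q}" for n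
    proof -
      obtain p where p: "p > 0" "(\<phi> ^^ p) (V n) = V n"
        using per by blast
      define i where "i = p * n - n"
      have i: "p * n = i + n" using p(1) by (simp add: i_def)
      have "V n = (\<phi> ^^ i) ((\<phi> ^^ n) (V n))"
        using funpow_fixpoint[OF p(2), of n] unfolding i by (simp add: funpow_add)
      also have "\<dots> = (\<phi> ^^ i) (V 0)"
        by (simp add: backward_orbit_funpow_diff[OF V])
      also have "\<dots> = (\<phi> ^^ (i mod q)) (V 0)"
        using funpow_mod_eq[OF q(2)] by metis
      finally show ?thesis using q(1) by auto
    qed
    then have "range V \<subseteq> (\<lambda>i. (\<phi> ^^ i) (V 0)) ` {..<q}" by blast
    then show False using inf finite_subset by blast
  qed
  then obtain N where "inj_on V {N..}" by blast
  then show ?thesis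
    unfolding eventually_sequentially by (meson atLeast_subset_iff inj_on_subset)
qed

definition common_tail :: "(nat \<Rightarrow> 'a) \<Rightarrow> (nat \<Rightarrow> 'a) \<Rightarrow> bool" where
  "common_tail V W \<longleftrightarrow> (\<exists>a b. \<forall>i. V (a + i) = W (b + i))"

lemma common_tail_refl: "common_tail V V"
  by (auto simp: common_tail_def)

lemma common_tail_sym: "common_tail V W \<Longrightarrow> common_tail W V"
  unfolding common_tail_def by metis

text \<open>Descending from a later meeting point to an earlier one takes the same number of steps
  along both backward orbits, since the second orbit is injective in that range.\<close>

lemma meeting_points_offset:
  assumes V: "backward_orbit \<phi> V" and W: "backward_orbit \<phi> W" and inj: "inj_on W {N..}"
    and eq0: "V i0 = W j0" and eq: "V i = W j"
    and le: "N \<le> j0" "i0 \<le> i" "i - i0 \<le> j - j0" "j0 \<le> j"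
  shows "i - i0 = j - j0"
proof -
  have "W (j - (i - i0)) = (\<phi> ^^ (i - i0)) (V i)"
    using le by (simp add: eq backward_orbit_funpow_diff[OF W])
  also have "\<dots> = W j0"
    using le eq0 by (simp add: backward_orbit_funpow_diff[OF V])
  finally have "j - (i - i0) = j0"
    using inj le by (auto simp: inj_on_def)
  then show ?thesis using le by linarith
qed

text \<open>If the tails always meet again, they do so with a constant index offset, and going down from
  ever later meeting points they coincide along the whole stretch.\<close>

lemma eventually_disjoint_tails:
  assumes V: "backward_orbit \<phi> V" and W: "backward_orbit \<phi> W"
    and "infinite (range V)" "infinite (range W)" and ncommon: "\<not> common_tail V W"
  shows "\<forall>\<^sub>F N in sequentially. V ` {N..} \<inter> W ` {N..} = {}"
proof -
  have "\<forall>\<^sub>F N in sequentially. inj_on V {N..} \<and> inj_on W {N..}"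
    using assms by (intro eventually_conj eventually_inj_on_tail)
  then obtain N0 where inj: "inj_on V {N0..}" "inj_on W {N0..}"
    by (auto simp: eventually_sequentially)
  have "\<exists>N. V ` {N..} \<inter> W ` {N..} = {}"
  proof (rule ccontr)
    assume "\<nexists>N. V ` {N..} \<inter> W ` {N..} = {}"
    then have "V ` {N..} \<inter> W ` {N..} \<noteq> {}" for N
      by blast
    then have meet: "\<exists>i\<ge>N. \<exists>j\<ge>N. V i = W j" for N
      by (simp add: set_eq_iff image_iff Bex_def) metis
    obtain i0 j0 where 0: "i0 \<ge> N0" "j0 \<ge> N0" "V i0 = W j0"
      using meet by blast
    have "V (i0 + r) = W (j0 + r)" for r
    proof -
      obtain i j where ij: "i \<ge> i0 + j0 + r" "j \<ge> i0 + j0 + r" "V i = W j"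
        using meet by blast
      have off: "i - i0 = j - j0"
      proof (cases "i - i0 \<le> j - j0")
        case True
        then show ?thesis
          using meeting_points_offset[OF V W inj(2) 0(3) ij(3)] 0 ij by simp
      next
        case False
        then show ?thesis
          using meeting_points_offset[OF W V inj(1) 0(3)[symmetric] ij(3)[symmetric]] 0 ij by simp
      qed
      define d where "d = i - i0 - r"
      have d: "i = i0 + r + d" "j = j0 + r + d"
        using off ij unfolding d_def by linarith+
      show ?thesis
        using ij(3) backward_orbit_funpow[OF V, of d "i0 + r"]
          backward_orbit_funpow[OF W, of d "j0 + r"] by (simp add: d)
    qed
    then show False using ncommon unfolding common_tail_def by blast
  qed
  then obtain N where N: "V ` {N..} \<inter> W ` {N..} = {}" by blast
  have "V ` {M..} \<inter> W ` {M..} = {}" if "M \<ge> N" for M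
  proof -
    have "V ` {M..} \<subseteq> V ` {N..}" "W ` {M..} \<subseteq> W ` {N..}"
      using that by (intro image_mono; simp)+
    then show ?thesis using N by blast
  qed
  then show ?thesis unfolding eventually_sequentially by blast
qed

section \<open>Filling the gaps in a string of an iterate\<close>

text \<open>The term \<open>T n\<close> belongs at position \<open>k * n\<close> of the filled sequence, hence the term at position
  \<open>n\<close> is found \<open>k * n - n\<close> steps of \<open>\<phi>\<close> further on.\<close>

definition filling :: "('a \<Rightarrow> 'a) \<Rightarrow> nat \<Rightarrow> (nat \<Rightarrow> 'a) \<Rightarrow> nat \<Rightarrow> 'a" where
  "filling \<phi> k T n = (\<phi> ^^ (k * n - n)) (T n)"

lemma backward_orbit_filling:
  assumes "k \<ge> 1" and T: "backward_orbit (\<phi> ^^ k) T"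
  shows "backward_orbit \<phi> (filling \<phi> k T)"
  unfolding backward_orbit_def
proof
  fix n
  have "Suc (k * Suc n - Suc n) = (k * n - n) + k"
    using assms(1) by (cases k) (simp_all add: algebra_simps)
  then have "\<phi> (filling \<phi> k T (Suc n)) = (\<phi> ^^ ((k * n - n) + k)) (T (Suc n))"
    unfolding filling_def by (metis funpow.simps(2) o_apply)
  also have "\<dots> = filling \<phi> k T n"
    using T by (simp add: filling_def funpow_add backward_orbit_def)
  finally show "\<phi> (filling \<phi> k T (Suc n)) = filling \<phi> k T n" .
qed

lemma filling_mult:
  assumes "k \<ge> 1" and T: "backward_orbit (\<phi> ^^ k) T"
  shows "filling \<phi> k T (k * n) = T n"
proof -
  have "k * (k * n) - k * n = k * (k * n - n)"
    by (simp add: diff_mult_distrib2)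
  then have "filling \<phi> k T (k * n) = ((\<phi> ^^ k) ^^ (k * n - n)) (T (k * n))"
    by (simp add: filling_def funpow_mult)
  also have "\<dots> = T n"
    using assms(1) by (simp add: backward_orbit_funpow_diff[OF T])
  finally show ?thesis .
qed

lemma infinite_range_filling:
  assumes "k \<ge> 1" "T \<in> strings (\<phi> ^^ k)"
  shows "infinite (range (filling \<phi> k T))"
proof -
  have T: "inj T" "backward_orbit (\<phi> ^^ k) T"
    using assms(2) by (auto simp: strings_iff)
  have "range T \<subseteq> range (filling \<phi> k T)"
    by (metis (no_types, lifting) filling_mult[OF assms(1) T(2)] image_subsetI rangeI)
  then show ?thesis
    using T(1) finite_subset range_inj_infinite by blast
qed

text \<open>A filling that joins the given tail with index offset \<open>b - a\<close> contributes to it the terms of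
  its string at the positions congruent to \<open>b - a\<close> modulo \<open>k\<close>. Strings with congruent
  offsets share a term, so disjointness makes the residue of the offset determine the string.\<close>

lemma card_common_tail_le:
  assumes "k \<ge> 1" and "finite F" and F: "F \<subseteq> strings (\<phi> ^^ k)"
    and disj: "disjoint_family_on range F"
  shows "card {T \<in> F. common_tail (filling \<phi> k T) W} \<le> k"
proof -
  let ?C = "{T \<in> F. common_tail (filling \<phi> k T) W}"
  have "\<forall>T\<in>?C. \<exists>p. \<forall>i. filling \<phi> k T (fst p + i) = W (snd p + i)"
    by (auto simp: common_tail_def)
  from bchoice[OF this] obtain p where
    "\<forall>T\<in>?C. \<forall>i. filling \<phi> k T (fst (p T) + i) = W (snd (p T) + i)" by blast
  then obtain a b where ab: "\<And>T i. T \<in> ?C \<Longrightarrow> filling \<phi> k T (a T + i) = W (b T + i)"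
    using that[of "fst \<circ> p" "snd \<circ> p"] by simp
  define res where "res T = (int (b T) - int (a T)) mod int k" for T
  have "inj_on res ?C"
  proof (rule inj_onI, rule ccontr)
    fix T1 T2 assume T: "T1 \<in> ?C" "T2 \<in> ?C" "res T1 = res T2" "T1 \<noteq> T2"
    \<comment> \<open>A position of the tail beyond both joining points that carries a term of \<open>T1\<close>.\<close>
    define q where "q = a T1 + a T2 + b T2"
    define m where "m = b T1 + (k * q - a T1)"
    have "q \<le> k * q"
      using assms(1) by simp
    then have m1: "b T1 + (m - b T1) = m" "a T1 + (m - b T1) = k * q"
      and m2: "b T2 + (m - b T2) = m"
      unfolding m_def q_def by linarith+
    have "int k dvd (int (b T1) - int (a T1)) - (int (b T2) - int (a T2))"
      using T(3) unfolding res_def by (simp add: mod_eq_dvd_iff)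
    moreover have "int k dvd int (a T1 + (m - b T1))"
      unfolding m1(2) by simp
    ultimately have "int k dvd (int (b T1) - int (a T1)) - (int (b T2) - int (a T2))
        + int (a T1 + (m - b T1))"
      by (rule dvd_add)
    also have "\<dots> = int (a T2 + (m - b T2))"
      using m1(1) m2 by linarith
    finally obtain y where y: "a T2 + (m - b T2) = k * y"
      unfolding int_dvd_int_iff by blast
    have "T1 q = filling \<phi> k T1 (a T1 + (m - b T1))"
      using T(1) F filling_mult[OF assms(1), of \<phi> T1] by (auto simp: m1(2) strings_iff)
    also have "\<dots> = W m"
      using ab[OF T(1), of "m - b T1"] unfolding m1(1) .
    also have "\<dots> = filling \<phi> k T2 (a T2 + (m - b T2))"
      using ab[OF T(2), of "m - b T2"] unfolding m2 by (rule sym)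
    also have "\<dots> = T2 y"
      using T(2) F filling_mult[OF assms(1), of \<phi> T2] by (auto simp: y strings_iff)
    finally have "range T1 \<inter> range T2 \<noteq> {}" by (metis disjoint_iff rangeI)
    then show False using disj T unfolding disjoint_family_on_def by blast
  qed
  moreover have "res ` ?C \<subseteq> {0..<int k}"
    using assms(1) by (auto simp: res_def)
  ultimately have "card ?C \<le> card {0..<int k}"
    by (rule card_inj_on_le) simp
  then show ?thesis by simp
qed

section \<open>Strings of a map and of its iterates\<close>

text \<open>A greedy choice: an element is taken unless it is related to one taken before.\<close>

lemma maximal_unrelated_subset:
  assumes "finite F" and refl: "\<And>x. R x x" and sym: "\<And>x y. R x y \<Longrightarrow> R y x"
  obtains M where "M \<subseteq> F" "\<And>x y. x \<in> M \<Longrightarrow> y \<in> M \<Longrightarrow> x \<noteq> y \<Longrightarrow> \<not> R x y"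
    "\<And>x. x \<in> F \<Longrightarrow> \<exists>y\<in>M. R x y"
proof -
  have "\<exists>M\<subseteq>F. (\<forall>x\<in>M. \<forall>y\<in>M. x \<noteq> y \<longrightarrow> \<not> R x y) \<and> (\<forall>x\<in>F. \<exists>y\<in>M. R x y)"
    using assms(1)
  proof (induction F)
    case (insert z F)
    then obtain M where M: "M \<subseteq> F" "\<forall>x\<in>M. \<forall>y\<in>M. x \<noteq> y \<longrightarrow> \<not> R x y"
      "\<forall>x\<in>F. \<exists>y\<in>M. R x y" by blast
    show ?case
    proof (cases "\<exists>y\<in>M. R z y")
      case True
      then show ?thesis using M by (intro exI[of _ M]) auto
    next
      case False
      then have "\<forall>y\<in>M. \<not> R z y \<and> \<not> R y z"
        using sym by metis
      then show ?thesis
        using M refl[of z] by (intro exI[of _ "insert z M"]) auto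
    qed
  qed simp
  then obtain M where "M \<subseteq> F" "\<forall>x\<in>M. \<forall>y\<in>M. x \<noteq> y \<longrightarrow> \<not> R x y" "\<forall>x\<in>F. \<exists>y\<in>M. R x y"
    by blast
  then show thesis by (intro that[of M]) auto
qed

text \<open>With \<open>A\<close> closed under preimages, this covers all, the non-singular and the null strings
  (\<open>string_sets_eq_strings_from\<close>).\<close>

definition strings_from :: "('a \<Rightarrow> 'a) \<Rightarrow> 'a set \<Rightarrow> (nat \<Rightarrow> 'a) set" where
  "strings_from \<phi> A = {S \<in> strings \<phi>. S 0 \<in> A}"

text \<open>Splitting each string of \<open>\<phi>\<close> by the residue of the index modulo \<open>k\<close>.\<close>

lemma mult_le_max_disjoint_funpow:
  assumes "k \<ge> 1" and closed: "\<And>x. \<phi> x \<in> A \<Longrightarrow> x \<in> A"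
    and "enat n \<le> max_disjoint (strings_from \<phi> A)"
  shows "enat (k * n) \<le> max_disjoint (strings_from (\<phi> ^^ k) A)"
proof -
  obtain F where F: "F \<subseteq> strings_from \<phi> A" "finite F" "card F = n" "disjoint_family_on range F"
    using assms(3) by (rule enat_le_max_disjointE)
  define h where "h = (\<lambda>(S :: nat \<Rightarrow> 'a, r) i. S (k * i + r))"
  have "enat (card (F \<times> {..<k})) \<le> max_disjoint (strings_from (\<phi> ^^ k) A)"
  proof (rule card_le_max_disjoint)
    show "finite (F \<times> {..<k})" using F by simp
  next
    fix p assume "p \<in> F \<times> {..<k}"
    then obtain S r where p: "p = (S, r)" "S \<in> F" "r < k" by auto
    have S: "inj S" "backward_orbit \<phi> S" "S 0 \<in> A"
      using F p by (auto simp: strings_from_def strings_iff)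
    have "inj (h p)"
      using assms(1) injD[OF S(1)] by (intro injI) (fastforce simp: h_def p(1))
    moreover have "backward_orbit (\<phi> ^^ k) (h p)"
      unfolding backward_orbit_def
    proof
      fix i
      show "(\<phi> ^^ k) (h p (Suc i)) = h p i"
        using backward_orbit_funpow[OF S(2), of k "k * i + r"]
        by (simp add: h_def p(1) add_ac)
    qed
    moreover have "h p 0 \<in> A"
      using backward_orbit_mem[OF S(2,3) closed] by (simp add: h_def p(1))
    ultimately show "h p \<in> strings_from (\<phi> ^^ k) A"
      by (simp add: strings_from_def strings_iff)
  next
    show "disjoint_family_on (\<lambda>p. range (h p)) (F \<times> {..<k})"
      unfolding disjoint_family_on_def
    proof (intro ballI impI, rule ccontr)
      fix p q assume pq: "p \<in> F \<times> {..<k}" "q \<in> F \<times> {..<k}" "p \<noteq> q"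
        and "range (h p) \<inter> range (h q) \<noteq> {}"
      then obtain i j where ij: "h p i = h q j" by blast
      obtain S r S' r' where p: "p = (S, r)" "S \<in> F" "r < k" and q: "q = (S', r')" "S' \<in> F" "r' < k"
        using pq by auto
      have eq: "S (k * i + r) = S' (k * j + r')" using ij by (simp add: h_def p q)
      then have "range S \<inter> range S' \<noteq> {}" by (metis disjoint_iff rangeI)
      then have "S = S'" using F(4) p q unfolding disjoint_family_on_def by blast
      moreover have "inj S" using F(1) p by (auto simp: strings_from_def strings_iff)
      ultimately have "k * i + r = k * j + r'" using eq by (auto simp: inj_def)
      then have "(k * i + r) mod k = (k * j + r') mod k" by simp
      then have "r = r'" using p q by simp
      then show False using pq p q \<open>S = S'\<close> by simp
    qed
  qed
  then show ?thesis using F by (simp add: card_cartesian_product mult.commute)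
qed

text \<open>The fillings of a maximal subfamily whose fillings pairwise share no tail, cut off far enough
  out, form the required family of strings of \<open>\<phi>\<close>.\<close>

lemma max_disjoint_funpow_le_mult:
  assumes k: "k \<ge> 1" and closed: "\<And>x. \<phi> x \<in> A \<Longrightarrow> x \<in> A"
    and "enat m \<le> max_disjoint (strings_from (\<phi> ^^ k) A)"
  shows "\<exists>n. m \<le> k * n \<and> enat n \<le> max_disjoint (strings_from \<phi> A)"
proof -
  obtain F where F: "F \<subseteq> strings_from (\<phi> ^^ k) A" "finite F" "card F = m" "disjoint_family_on range F"
    using assms(3) by (rule enat_le_max_disjointE)
  let ?V = "filling \<phi> k"
  have strF: "F \<subseteq> strings (\<phi> ^^ k)" using F by (auto simp: strings_from_def)
  obtain M where M: "M \<subseteq> F"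
      "\<And>T T'. T \<in> M \<Longrightarrow> T' \<in> M \<Longrightarrow> T \<noteq> T' \<Longrightarrow> \<not> common_tail (?V T) (?V T')"
      "\<And>T. T \<in> F \<Longrightarrow> \<exists>T'\<in>M. common_tail (?V T) (?V T')"
    using maximal_unrelated_subset[OF F(2), of "\<lambda>T T'. common_tail (?V T) (?V T')"]
      common_tail_refl common_tail_sym by metis
  have finM: "finite M" using M(1) F(2) finite_subset by blast
  have orbit: "backward_orbit \<phi> (?V T)" and inf: "infinite (range (?V T))" if "T \<in> M" for T
    using that M(1) strF backward_orbit_filling[OF k, of \<phi> T] infinite_range_filling[OF k, of T \<phi>]
    by (auto simp: strings_iff)

  have "F = (\<Union>T'\<in>M. {T \<in> F. common_tail (?V T) (?V T')})"
    using M(3) by blast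
  then have "card F = card (\<Union>T'\<in>M. {T \<in> F. common_tail (?V T) (?V T')})"
    by (rule arg_cong)
  also have "\<dots> \<le> (\<Sum>T'\<in>M. card {T \<in> F. common_tail (?V T) (?V T')})"
    by (rule card_UN_le[OF finM])
  also have "\<dots> \<le> (\<Sum>T'\<in>M. k)"
    by (intro sum_mono card_common_tail_le[OF k F(2) strF F(4)])
  finally have card: "m \<le> k * card M" using F(3) by (simp add: mult.commute)

  have "\<forall>\<^sub>F N in sequentially. \<forall>T\<in>M. inj_on (?V T) {N..}"
    using eventually_inj_on_tail[OF orbit inf]
    by (intro eventually_ball_finite[OF finM] ballI)
  moreover have "\<forall>\<^sub>F N in sequentially. \<forall>T\<in>M. \<forall>T'\<in>M. T \<noteq> T' \<longrightarrow>
      ?V T ` {N..} \<inter> ?V T' ` {N..} = {}"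
  proof (intro eventually_ball_finite[OF finM] ballI)
    fix T T' assume "T \<in> M" "T' \<in> M"
    then show "\<forall>\<^sub>F N in sequentially. T \<noteq> T' \<longrightarrow> ?V T ` {N..} \<inter> ?V T' ` {N..} = {}"
      using eventually_disjoint_tails[OF orbit orbit inf inf] M(2)
      by (cases "T = T'") auto
  qed
  ultimately have "\<forall>\<^sub>F N in sequentially. (\<forall>T\<in>M. inj_on (?V T) {N..}) \<and>
      (\<forall>T\<in>M. \<forall>T'\<in>M. T \<noteq> T' \<longrightarrow> ?V T ` {N..} \<inter> ?V T' ` {N..} = {})"
    by (rule eventually_conj)
  then obtain N where injN: "\<And>T. T \<in> M \<Longrightarrow> inj_on (?V T) {N..}"
    and disjN: "\<And>T T'. T \<in> M \<Longrightarrow> T' \<in> M \<Longrightarrow> T \<noteq> T' \<Longrightarrow> ?V T ` {N..} \<inter> ?V T' ` {N..} = {}"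
    unfolding eventually_sequentially by blast
  have "enat (card M) \<le> max_disjoint (strings_from \<phi> A)"
  proof (rule card_le_max_disjoint[where h = "\<lambda>T i. ?V T (N + i)"])
    fix T assume T: "T \<in> M"
    have "inj (\<lambda>i. ?V T (N + i))"
      using inj_onD[OF injN[OF T]] by (intro injI) fastforce
    moreover have "backward_orbit \<phi> (\<lambda>i. ?V T (N + i))"
      using orbit[OF T] by (simp add: backward_orbit_def)
    moreover have "?V T 0 \<in> A"
      using T M(1) F(1) by (auto simp: strings_from_def filling_def)
    then have "?V T N \<in> A"
      using backward_orbit_mem[OF orbit[OF T]] closed by blast
    ultimately show "(\<lambda>i. ?V T (N + i)) \<in> strings_from \<phi> A"
      by (simp add: strings_from_def strings_iff)
  next
    have sub: "range (\<lambda>i. ?V T (N + i)) \<subseteq> ?V T ` {N..}" for T by auto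
    show "disjoint_family_on (\<lambda>T. range (\<lambda>i. ?V T (N + i))) M"
      unfolding disjoint_family_on_def
    proof (intro ballI impI)
      fix T T' assume "T \<in> M" "T' \<in> M" "T \<noteq> T'"
      then show "range (\<lambda>i. ?V T (N + i)) \<inter> range (\<lambda>i. ?V T' (N + i)) = {}"
        using Int_mono[OF sub[of T] sub[of T']] disjN by simp
    qed
  qed (rule finM)
  then show ?thesis using card by blast
qed

lemma max_disjoint_strings_from_funpow:
  assumes "k \<ge> 1" and "\<And>x. \<phi> x \<in> A \<Longrightarrow> x \<in> A"
  shows "max_disjoint (strings_from (\<phi> ^^ k) A) = enat k * max_disjoint (strings_from \<phi> A)"
  using assms
  by (intro enat_eq_multI mult_le_max_disjoint_funpow max_disjoint_funpow_le_mult)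

section \<open>The three string numbers\<close>

lemma quasi_periodic_image:
  assumes "x \<in> quasi_periodic \<phi>"
  shows "\<phi> x \<in> quasi_periodic \<phi>"
proof -
  obtain n m where "n < m" "(\<phi> ^^ n) x = (\<phi> ^^ m) x"
    using assms by (auto simp: quasi_periodic_def)
  then have "n < m \<and> (\<phi> ^^ n) (\<phi> x) = (\<phi> ^^ m) (\<phi> x)"
    by (simp add: funpow_swap1[symmetric])
  then show ?thesis unfolding quasi_periodic_def by blast
qed

lemma quasi_periodic_funpow:
  assumes "k \<ge> 1"
  shows "quasi_periodic (\<phi> ^^ k) = quasi_periodic \<phi>"
proof (intro equalityI subsetI)
  fix x assume "x \<in> quasi_periodic (\<phi> ^^ k)"
  then obtain n m where "n < m" "(\<phi> ^^ (k * n)) x = (\<phi> ^^ (k * m)) x"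
    by (auto simp: quasi_periodic_def funpow_mult)
  moreover have "k * n < k * m" using \<open>n < m\<close> assms by simp
  ultimately show "x \<in> quasi_periodic \<phi>" unfolding quasi_periodic_def by blast
next
  fix x assume "x \<in> quasi_periodic \<phi>"
  then obtain n m where nm: "n < m" "(\<phi> ^^ n) x = (\<phi> ^^ m) x"
    by (auto simp: quasi_periodic_def)
  \<comment> \<open>From time \<open>n\<close> on the orbit has period \<open>m - n\<close>, hence also period \<open>k * (m - n)\<close>; the time
    \<open>k * n\<close> is late enough and a multiple of \<open>k\<close>.\<close>
  define y where "y = (\<phi> ^^ (k * n)) x"
  have "k * n = (k * n - n) + n" using assms by simp
  then have y: "y = (\<phi> ^^ (k * n - n)) ((\<phi> ^^ n) x)"
    unfolding y_def by (metis funpow_add o_apply)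
  have "(\<phi> ^^ (m - n)) y = (\<phi> ^^ (m - n + (k * n - n) + n)) x"
    by (simp add: y funpow_add)
  also have "m - n + (k * n - n) + n = (k * n - n) + m"
    using nm(1) by simp
  also have "(\<phi> ^^ \<dots>) x = y"
    by (simp add: y nm(2) funpow_add)
  finally have "(\<phi> ^^ ((m - n) * k)) y = y"
    by (rule funpow_fixpoint)
  then have "(\<phi> ^^ ((m - n) * k + k * n)) x = (\<phi> ^^ (k * n)) x"
    by (simp add: y_def funpow_add)
  also have "(m - n) * k + k * n = k * m"
    using nm(1) by (simp add: algebra_simps)
  finally have "n < m \<and> ((\<phi> ^^ k) ^^ n) x = ((\<phi> ^^ k) ^^ m) x"
    using nm(1) by (simp add: funpow_mult)
  then show "x \<in> quasi_periodic (\<phi> ^^ k)"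
    unfolding quasi_periodic_def by blast
qed

definition null_points :: "('a::zero \<Rightarrow> 'a) \<Rightarrow> 'a set" where
  "null_points \<phi> = {x. x \<noteq> 0 \<and> (\<exists>j\<ge>1. (\<phi> ^^ j) x = 0)}"

lemma null_points_preimage:
  assumes "\<phi> 0 = 0" "\<phi> x \<in> null_points \<phi>"
  shows "x \<in> null_points \<phi>"
proof -
  obtain j where "\<phi> x \<noteq> 0" "(\<phi> ^^ j) (\<phi> x) = 0"
    using assms(2) by (auto simp: null_points_def)
  then have "x \<noteq> 0" "(\<phi> ^^ Suc j) x = 0"
    using assms(1) by (auto simp: funpow_swap1)
  then show ?thesis unfolding null_points_def by (metis (mono_tags) One_nat_def Suc_le_mono le0 mem_Collect_eq)
qed

lemma null_points_funpow:
  assumes "\<phi> 0 = 0" "k \<ge> 1"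
  shows "null_points (\<phi> ^^ k) = null_points \<phi>"
proof (intro equalityI subsetI)
  fix x assume "x \<in> null_points (\<phi> ^^ k)"
  then obtain j where "x \<noteq> 0" "j \<ge> 1" "(\<phi> ^^ (k * j)) x = 0"
    by (auto simp: null_points_def funpow_mult)
  moreover have "k * j \<ge> 1" using \<open>j \<ge> 1\<close> assms(2) by simp
  ultimately show "x \<in> null_points \<phi>" unfolding null_points_def by blast
next
  fix x assume "x \<in> null_points \<phi>"
  then obtain j where j: "x \<noteq> 0" "j \<ge> 1" "(\<phi> ^^ j) x = 0"
    by (auto simp: null_points_def)
  have zero: "(\<phi> ^^ i) 0 = 0" for i
    by (induction i) (simp_all add: assms(1))
  have "k * j = (k * j - j) + j" using assms(2) by simp
  then have "(\<phi> ^^ (k * j)) x = (\<phi> ^^ (k * j - j)) ((\<phi> ^^ j) x)"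
    by (metis funpow_add o_apply)
  then have "((\<phi> ^^ k) ^^ j) x = 0"
    by (simp add: funpow_mult j(3) zero)
  then show "x \<in> null_points (\<phi> ^^ k)" using j unfolding null_points_def by blast
qed

lemma string_sets_eq_strings_from:
  "strings \<phi> = strings_from \<phi> UNIV"
  "nonsingular_strings \<phi> = strings_from \<phi> (- quasi_periodic \<phi>)"
  "null_strings \<psi> = strings_from \<psi> (null_points \<psi>)"
  by (auto simp: strings_from_def nonsingular_strings_def null_strings_def null_points_def)

theorem corollary4p6:
  fixes \<phi> :: "'a::ab_group_add \<Rightarrow> 'a" and k :: nat
  assumes "Modules.additive \<phi>" and "k \<ge> 1"
  shows "string_number (\<phi> ^^ k) = enat k * string_number \<phi>
       \<and> nonsingular_string_number (\<phi> ^^ k) = enat k * nonsingular_string_number \<phi>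
       \<and> null_string_number (\<phi> ^^ k) = enat k * null_string_number \<phi>"
proof (intro conjI)
  have zero: "\<phi> 0 = 0" using assms(1) by (rule Modules.additive.zero)
  show "string_number (\<phi> ^^ k) = enat k * string_number \<phi>"
    unfolding string_number_def string_sets_eq_strings_from
    using assms(2) by (intro max_disjoint_strings_from_funpow) simp_all
  show "nonsingular_string_number (\<phi> ^^ k) = enat k * nonsingular_string_number \<phi>"
    unfolding nonsingular_string_number_def string_sets_eq_strings_from
      quasi_periodic_funpow[OF assms(2)]
    by (intro max_disjoint_strings_from_funpow assms(2)) (auto dest: quasi_periodic_image)
  show "null_string_number (\<phi> ^^ k) = enat k * null_string_number \<phi>"
    unfolding null_string_number_def string_sets_eq_strings_from
      null_points_funpow[of \<phi>, OF zero assms(2)]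
    using assms(2) null_points_preimage[of \<phi>, OF zero] by (intro max_disjoint_strings_from_funpow)
qed

end
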